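(* Let $q$ be a prime power, $m\ge 1$ an integer, and $f:\mathbb{F}_q^m\to\mathbb{F}_q$ a function such that for every $\omega\in\mathbb{F}_q^m$ there is some $\mathbf{x}\in\mathbb{F}_q^m\setminus\{\mathbf{0}\}$ with $f(\mathbf{x})\neq\omega\cdot\mathbf{x}$. Let $u=0$ and let $\mathbf{v}\in\mathbb{F}_q^m$ with $\mathbf{v}\neq\mathbf{0}$. Then the codeword $\mathbf{c}(u,\mathbf{v})=\mathbf{c}(0,\mathbf{v})$ is minimal in $\mathcal{C}_f$ if and only if there exist $\alpha_1,\dots,\alpha_m\in H(\mathbf{v})\setminus\{\mathbf{0}\}$ such that $\mathbf{d}_{\alpha_1},\dots,\mathbf{d}_{\alpha_m}$ are linearly independent over $\mathbb{F}_q$.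
   Context: For $\mathbf{x},\mathbf{y}\in\mathbb{F}_q^m$, $\mathbf{x}\cdot\mathbf{y}=\sum_i x_iy_i$. For $\mathbf{v}\in\mathbb{F}_q^m$, $H(\mathbf{v})=\{\mathbf{x}\in\mathbb{F}_q^m : \mathbf{x}\cdot\mathbf{v}=0\}$. For $\mathbf{x}\in\mathbb{F}_q^m\setminus\{\mathbf{0}\}$, $\mathbf{d}_{\mathbf{x}}=(f(\mathbf{x}),\mathbf{x})\in\mathbb{F}_q^{m+1}$. For $u\in\mathbb{F}_q$ and $\mathbf{v}\in\mathbb{F}_q^m$ put $\mathbf{c}(u,\mathbf{v})=(uf(\mathbf{x})+\mathbf{v}\cdot\mathbf{x})_{\mathbf{x}\in\mathbb{F}_q^m\setminus\{\mathbf{0}\}}\in\mathbb{F}_q^{q^m-1}$, and let $\mathcal{C}_f=\{\mathbf{c}(u,\mathbf{v}) : u\in\mathbb{F}_q,\ \mathbf{v}\in\mathbb{F}_q^m\}$; under the assumption on $f$ this is a $[q^m-1,m+1]_q$ linear code. The support of a vector is the set of its coordinate positions with nonzero entry; $\mathbf{b}\preceq\mathbf{c}$ ($\mathbf{c}$ covers $\mathbf{b}$) means that the support of $\mathbf{b}$ is contained in the support of $\mathbf{c}$. A codeword $\mathbf{c}$ of a linear code $\mathcal{C}$ is minimal in $\mathcal{C}$ if for every $\mathbf{b}\in\mathcal{C}$, $\mathbf{b}\preceq\mathbf{c}$ implies $\mathbf{b}=a\mathbf{c}$ for some $a\in\mathbb{F}_q$. *)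

theory Defs
  imports "HOL-Analysis.Cartesian_Space"
begin

text \<open>The field with \<open>q\<close> elements is an arbitrary type \<open>'a :: {field, finite}\<close> (so \<open>q = CARD('a)\<close>), and
  \<open>m = CARD('m)\<close>. The dimension \<open>m + 1\<close> is the index type \<open>'m option\<close>, with \<open>None\<close> as the additional
  first coordinate. Codewords are indexed by the following type of nonzero vectors, which has
  \<open>q ^ m - 1\<close> elements.\<close>

typedef (overloaded) ('a, 'm) nonzero_vec =
  "{x :: ('a :: zero_neq_one) ^ ('m :: finite). x \<noteq> 0}"
  morphisms vec_of Nonzero_vec
proof -
  have "(\<chi> i. 1) \<noteq> (0 :: 'a ^ 'm)"
    by (simp add: vec_eq_iff)
  then show ?thesis by blast
qed

instance nonzero_vec :: ("{zero_neq_one, finite}", finite) finite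
proof
  have "range (vec_of :: ('a, 'b) nonzero_vec \<Rightarrow> 'a ^ 'b) \<subseteq> UNIV" by simp
  then have "finite (range (vec_of :: ('a, 'b) nonzero_vec \<Rightarrow> 'a ^ 'b))"
    by (rule finite_subset) (rule finite)
  moreover have "inj (vec_of :: ('a, 'b) nonzero_vec \<Rightarrow> 'a ^ 'b)"
    by (simp add: inj_def vec_of_inject)
  ultimately show "finite (UNIV :: ('a, 'b) nonzero_vec set)"
    by (rule finite_imageD)
qed

lemma card_nonzero_vec:
  "CARD(('a :: {zero_neq_one, finite}, 'm :: finite) nonzero_vec) = CARD('a) ^ CARD('m) - 1"
proof -
  have "CARD(('a, 'm) nonzero_vec) = card {x :: 'a ^ 'm. x \<noteq> 0}"
    by (rule type_definition.card[OF type_definition_nonzero_vec])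
  also have "{x :: 'a ^ 'm. x \<noteq> 0} = UNIV - {0}" by auto
  finally show ?thesis by (simp add: card_Diff_singleton)
qed

definition dot :: "('a :: field) ^ 'm \<Rightarrow> 'a ^ 'm \<Rightarrow> 'a" (infixl "\<odot>" 70)
  where "x \<odot> y = (\<Sum>i\<in>UNIV. x $ i * y $ i)"

definition hyperplane :: "('a :: field) ^ 'm \<Rightarrow> ('a ^ 'm) set"
  where "hyperplane v = {x. x \<odot> v = 0}"

definition graph_vec :: "(('a :: field) ^ 'm \<Rightarrow> 'a) \<Rightarrow> 'a ^ 'm \<Rightarrow> 'a ^ 'm option"
  where "graph_vec f x = (\<chi> i. case i of None \<Rightarrow> f x | Some j \<Rightarrow> x $ j)"

definition codeword ::
    "(('a :: {field, finite}) ^ ('m :: finite) \<Rightarrow> 'a) \<Rightarrow> 'a \<Rightarrow> 'a ^ 'm \<Rightarrow> 'a ^ ('a, 'm) nonzero_vec"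
  where "codeword f u v = (\<chi> x. u * f (vec_of x) + v \<odot> vec_of x)"

definition code_of ::
    "(('a :: {field, finite}) ^ ('m :: finite) \<Rightarrow> 'a) \<Rightarrow> ('a ^ ('a, 'm) nonzero_vec) set"
  where "code_of f = {codeword f u v | u v. True}"

definition support :: "('a :: zero) ^ 'n \<Rightarrow> 'n set"
  where "support c = {i. c $ i \<noteq> 0}"

definition covers :: "('a :: zero) ^ 'n \<Rightarrow> 'a ^ 'n \<Rightarrow> bool" (infix "\<preceq>" 50)
  where "b \<preceq> c \<longleftrightarrow> support b \<subseteq> support c"

definition minimal_codeword :: "(('a :: field) ^ 'n) set \<Rightarrow> 'a ^ 'n \<Rightarrow> bool"
  where "minimal_codeword C c \<longleftrightarrow> c \<in> C \<and> (\<forall>b\<in>C. b \<preceq> c \<longrightarrow> (\<exists>a. b = a *s c))"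

lemma subspace_code_of:
  fixes f :: "('a :: {field, finite}) ^ 'm \<Rightarrow> 'a"
  shows "vec.subspace (code_of f)"
proof (rule vec.subspaceI)
  have "codeword f 0 0 = 0"
    by (simp add: codeword_def dot_def vec_eq_iff)
  then show "0 \<in> code_of f" unfolding code_of_def by (metis (mono_tags, lifting) mem_Collect_eq)
next
  fix b c assume "b \<in> code_of f" "c \<in> code_of f"
  then obtain u v u' v' where "b = codeword f u v" "c = codeword f u' v'"
    unfolding code_of_def by blast
  then have "b + c = codeword f (u + u') (v + v')"
    by (simp add: codeword_def dot_def vec_eq_iff algebra_simps sum.distrib)
  then show "b + c \<in> code_of f" unfolding code_of_def by blast
next
  fix a c assume "c \<in> code_of f"
  then obtain u v where "c = codeword f u v"
    unfolding code_of_def by blast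
  then have "a *s c = codeword f (a * u) (a *s v)"
    by (simp add: codeword_def dot_def vec_eq_iff algebra_simps sum_distrib_left)
  then show "a *s c \<in> code_of f" unfolding code_of_def by blast
qed

end

theory Submission
  imports Defs
begin

text \<open>A codeword \<open>c(u', v')\<close> is covered by \<open>c(0, v)\<close> iff the functional \<open>(u', v')\<close> annihilates the set \<open>S\<close>
  of all \<open>d\<^sub>x\<close> with \<open>x \<in> H(v) - {0}\<close>. The hypothesis on \<open>f\<close> makes \<open>(u', v') \<mapsto> c(u', v')\<close> injective, so
  \<open>c(0, v)\<close> is minimal iff the annihilator of \<open>S\<close> is the line through \<open>(0, v)\<close>, i.e. iff \<open>S\<close> has
  rank \<open>m\<close>.\<close>

lemma dot_add_left: "(x + y) \<odot> z = x \<odot> z + y \<odot> z"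
  by (simp add: dot_def algebra_simps sum.distrib)

lemma dot_diff_left: "(x - y) \<odot> z = x \<odot> z - y \<odot> z"
  by (simp add: dot_def algebra_simps sum_subtractf)

lemma dot_scale_left: "(a *s x) \<odot> z = a * (x \<odot> z)"
  by (simp add: dot_def algebra_simps sum_distrib_left)

lemma dot_commute: "x \<odot> y = y \<odot> x"
  by (simp add: dot_def mult.commute)

lemma dot_axis: "x \<odot> axis i 1 = x $ i"
  by (simp add: dot_def axis_def if_distrib [of "(*) _"] cong: if_cong)

lemma subspace_hyperplane: "vec.subspace (hyperplane v)"
  by (rule vec.subspaceI)
    (simp_all add: hyperplane_def dot_add_left dot_scale_left, simp add: dot_def)

lemma hyperplane_eq_UNIV: "hyperplane v = UNIV \<Longrightarrow> v = 0"
  by (metis (mono_tags, lifting) UNIV_I dot_axis dot_commute hyperplane_def mem_Collect_eq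
      vec_eq_iff zero_index)

text \<open>The coordinate functional of \<open>w\<close> relative to \<open>B\<close>, realised as
  a dot product: prescribe a linear map on \<open>B\<close>, extend it to the whole space and take
  one row of its matrix.\<close>

lemma dual_vector_exists:
  fixes B :: "(('a :: field) ^ 'n) set"
  assumes "vec.independent B" and "w \<in> B"
  obtains y where "y \<odot> w = 1" and "\<And>b. b \<in> B \<Longrightarrow> b \<noteq> w \<Longrightarrow> y \<odot> b = 0"
proof -
  \<comment> \<open>Any coordinate will do; \<open>k\<close> only embeds the scalar values 0 and 1
    into the codomain of \<open>g\<close>.\<close>
  fix k :: 'n
  obtain g :: "'a ^ 'n \<Rightarrow> 'a ^ 'n" where g: "Vector_Spaces.linear (*s) (*s) g"
    and gB: "\<forall>x\<in>B. g x = (if x = w then axis k 1 else 0)"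
    using vec.linear_independent_extend [OF assms(1), of "\<lambda>x. if x = w then axis k 1 else 0"] by blast
  have dot: "row k (matrix g) \<odot> x = g x $ k" for x
    using matrix_works [OF g, of x]
    by (simp add: dot_def row_def matrix_vector_mult_def vec_eq_iff)
  show thesis
    by (rule that [of "row k (matrix g)"]) (use gB assms(2) in \<open>auto simp: dot\<close>)
qed

text \<open>The span of \<open>B\<close> has codimension at most one, so a vector annihilating
  \<open>B\<close> is determined by its pairing with a single \<open>w\<close> outside that
  span.\<close>

lemma annihilator_proportional:
  fixes B :: "(('a :: field) ^ 'n) set"
  assumes B: "vec.independent B" "CARD('n) \<le> Suc (card B)"
    and y: "B \<subseteq> hyperplane y" and z: "B \<subseteq> hyperplane z" "z \<noteq> 0"
  shows "\<exists>a. y = a *s z"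
proof -
  have eq_0: "t = 0" if "w \<odot> t = 0" "B \<subseteq> hyperplane t" "w \<notin> vec.span B" for t w
  proof -
    have ind: "vec.independent (insert w B)"
      using B(1) that(3) by (simp add: vec.independent_insertI)
    have "w \<notin> B" using that(3) vec.span_base by blast
    then have "CARD('n) \<le> card (insert w B)"
      using B vec.finiteI_independent [OF B(1)] by simp
    then have "UNIV \<subseteq> vec.span (insert w B)"
      using ind by (metis vec.card_ge_dim_independent vec_dim_card subset_UNIV)
    also have "\<dots> \<subseteq> hyperplane t"
      using that by (intro vec.span_minimal subspace_hyperplane) (auto simp: hyperplane_def)
    finally show "t = 0" using hyperplane_eq_UNIV by blast
  qed
  have "vec.span B \<subseteq> hyperplane z"
    using z(1) by (intro vec.span_minimal subspace_hyperplane)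
  then obtain w where w: "w \<notin> vec.span B"
    using hyperplane_eq_UNIV z(2) by blast
  \<comment> \<open>Otherwise \<open>eq_0\<close> applied to \<open>z\<close> itself would give
    \<open>z = 0\<close>.\<close>
  have wz: "w \<odot> z \<noteq> 0" using eq_0 w z by blast
  \<comment> \<open>This choice makes \<open>y - a *s z\<close> vanish at \<open>w\<close> as well
    as on \<open>B\<close>.\<close>
  define a where "a = (w \<odot> y) / (w \<odot> z)"
  have "b \<odot> (y - a *s z) = b \<odot> y - a * (b \<odot> z)" for b
    by (metis dot_commute dot_diff_left dot_scale_left)
  then have "y - a *s z = 0"
    using wz y z(1) w by (intro eq_0 [of w]) (auto simp: a_def hyperplane_def subset_iff)
  then show ?thesis by auto
qed

text \<open>Extend a maximal independent \<open>B\<close> inside \<open>S\<close> to a basis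
  \<open>C\<close>. Each vector of \<open>C - B\<close> has a dual functional annihilating
  \<open>S\<close>, and a line of annihilators leaves room for only one of them.\<close>

lemma annihilator_line_imp_rank:
  fixes S :: "(('a :: field) ^ 'n) set"
  assumes "\<And>y. S \<subseteq> hyperplane y \<Longrightarrow> \<exists>a. y = a *s z"
  shows "\<exists>B\<subseteq>S. vec.independent B \<and> CARD('n) \<le> Suc (card B)"
proof -
  obtain B where B: "B \<subseteq> S" "vec.independent B" "S \<subseteq> vec.span B"
    using vec.maximal_independent_subset by blast
  define C where "C = vec.extend_basis B"
  have C: "B \<subseteq> C" "vec.independent C" "vec.span C = UNIV"
    using B(2) vec.extend_basis_superset vec.independent_extend_basis vec.span_extend_basis
    by (auto simp: C_def)
  have fin: "finite C" "finite B" using B(2) C(2) vec.finiteI_independent by auto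
  have "card C = CARD('n)"
    using vec.dim_eq_card_independent [OF C(2)] C(3) vec.dim_span [of C] by (metis vec_dim_card)
  then have card: "CARD('n) = card B + card (C - B)"
    using C(1) fin by (metis card_Un_disjoint Diff_disjoint Un_Diff_cancel finite_Diff sup.absorb_iff2)
  have scaled: "\<exists>a. y = a *s z" if "\<And>b. b \<in> B \<Longrightarrow> y \<odot> b = 0" for y
  proof (rule assms)
    have "B \<subseteq> hyperplane y" using that by (auto simp: hyperplane_def dot_commute)
    then show "S \<subseteq> hyperplane y"
      using B(3) vec.span_minimal subspace_hyperplane by blast
  qed
  have "w1 = w2" if w: "w1 \<in> C - B" "w2 \<in> C - B" for w1 w2
  proof (rule ccontr)
    assume "w1 \<noteq> w2"
    obtain y1 where y1: "y1 \<odot> w1 = 1" "\<And>b. b \<in> C \<Longrightarrow> b \<noteq> w1 \<Longrightarrow> y1 \<odot> b = 0"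
      using dual_vector_exists [OF C(2)] w by blast
    obtain y2 where y2: "y2 \<odot> w2 = 1" "\<And>b. b \<in> C \<Longrightarrow> b \<noteq> w2 \<Longrightarrow> y2 \<odot> b = 0"
      using dual_vector_exists [OF C(2)] w by blast
    obtain a1 where a1: "y1 = a1 *s z" using scaled [of y1] y1 w C(1) by blast
    obtain a2 where a2: "y2 = a2 *s z" using scaled [of y2] y2 w C(1) by blast
    \<comment> \<open>The third equation forces \<open>a2\<close> to be nonzero, the second then
      gives \<open>z \<odot> w1 = 0\<close>, against the first.\<close>
    have "a1 * (z \<odot> w1) = 1" "a2 * (z \<odot> w1) = 0" "a2 * (z \<odot> w2) = 1"
      using y1(1) y2 w \<open>w1 \<noteq> w2\<close> by (auto simp: a1 a2 dot_scale_left)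
    then show False by auto
  qed
  then have "card (C - B) \<le> Suc 0"
    using fin by (simp add: card_le_Suc0_iff_eq)
  then show ?thesis using B card by (intro exI [of _ B]) auto
qed

text \<open>Splitting off the coordinate \<open>None\<close> shows that each entry of a codeword is
  the pairing of its coefficient vector \<open>y\<close> with a graph vector.\<close>

lemma dot_graph_vec: "y \<odot> graph_vec f x = y $ None * f x + (\<chi> j. y $ Some j) \<odot> x"
  by (simp add: dot_def graph_vec_def UNIV_option_conv sum.reindex)

lemma codeword_eq_iff:
  assumes "\<And>w. \<exists>x. x \<noteq> 0 \<and> f x \<noteq> w \<odot> x"
  shows "codeword f u v = codeword f u' v' \<longleftrightarrow> u = u' \<and> v = v'"
proof
  assume eq: "codeword f u v = codeword f u' v'"
  have val: "u * f x + v \<odot> x = u' * f x + v' \<odot> x" if "x \<noteq> 0" for x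
  proof -
    have "codeword f u v $ Nonzero_vec x = codeword f u' v' $ Nonzero_vec x"
      using eq by simp
    then show ?thesis using that by (simp add: codeword_def Nonzero_vec_inverse)
  qed
  have u: "u = u'"
  proof (rule ccontr)
    assume ne: "u \<noteq> u'"
    \<comment> \<open>If \<open>u\<close> and \<open>u'\<close> differed, equality of the codewords
      would make \<open>f\<close> agree with this linear form at every nonzero vector.\<close>
    obtain x where x: "x \<noteq> 0" "f x \<noteq> ((1 / (u - u')) *s (v' - v)) \<odot> x" using assms by blast
    have "(u - u') * f x = (v' - v) \<odot> x"
      using val [OF x(1)] unfolding dot_diff_left by algebra
    then show False
      using x(2) ne by (simp add: dot_scale_left nonzero_eq_divide_eq mult.commute)
  qed
  have "v $ i = v' $ i" for i
    using val [of "axis i 1"] u by (simp add: dot_axis axis_eq_0_iff)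
  then show "u = u' \<and> v = v'" using u by (simp add: vec_eq_iff)
qed simp

lemma scale_codeword: "a *s codeword f u v = codeword f (a * u) (a *s v)"
  by (simp add: codeword_def dot_scale_left vec_eq_iff algebra_simps)

lemma covers_codeword_iff:
  "codeword f (y $ None) (\<chi> j. y $ Some j) \<preceq> codeword f 0 v \<longleftrightarrow>
    graph_vec f ` (hyperplane v - {0}) \<subseteq> hyperplane y"
proof -
  have "codeword f (y $ None) (\<chi> j. y $ Some j) \<preceq> codeword f 0 v \<longleftrightarrow>
      (\<forall>x. y \<odot> graph_vec f (vec_of x) \<noteq> 0 \<longrightarrow> v \<odot> vec_of x \<noteq> 0)"
    by (auto simp: covers_def support_def codeword_def dot_graph_vec)
  also have "\<dots> \<longleftrightarrow> (\<forall>x. x \<noteq> 0 \<longrightarrow> y \<odot> graph_vec f x \<noteq> 0 \<longrightarrow> v \<odot> x \<noteq> 0)"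
    using vec_of Nonzero_vec_inverse by (metis (mono_tags, lifting) mem_Collect_eq)
  also have "\<dots> \<longleftrightarrow> graph_vec f ` (hyperplane v - {0}) \<subseteq> hyperplane y"
    by (auto simp: hyperplane_def dot_commute)
  finally show ?thesis .
qed

text \<open>\<open>graph_vec (\<lambda>_. u) v\<close> serves as the pair \<open>(u, v)\<close> in dimension \<open>m + 1\<close>.\<close>

lemma minimal_codeword_iff_annihilator:
  assumes "\<And>w. \<exists>x. x \<noteq> 0 \<and> f x \<noteq> w \<odot> x"
  shows "minimal_codeword (code_of f) (codeword f 0 v) \<longleftrightarrow>
    (\<forall>y. graph_vec f ` (hyperplane v - {0}) \<subseteq> hyperplane y \<longrightarrow>
      (\<exists>a. y = a *s graph_vec (\<lambda>_. 0) v))"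
proof -
  \<comment> \<open>Merging the pair of coefficients into one vector \<open>y\<close> turns
    quantification over codewords into quantification over functionals in dimension m + 1.\<close>
  have code: "code_of f = range (\<lambda>y. codeword f (y $ None) (\<chi> j. y $ Some j))"
  proof -
    have "codeword f u w \<in> range (\<lambda>y. codeword f (y $ None) (\<chi> j. y $ Some j))" for u w
      by (rule range_eqI [of _ _ "graph_vec (\<lambda>_. u) w"]) (simp add: graph_vec_def)
    then show ?thesis by (auto simp: code_of_def)
  qed
  have "codeword f 0 v \<in> code_of f" by (auto simp: code_of_def)
  \<comment> \<open>Injectivity of the encoding carries proportionality of codewords over to their
    coefficient vectors.\<close>
  moreover have "codeword f (y $ None) (\<chi> j. y $ Some j) = a *s codeword f 0 v \<longleftrightarrow>
      y = a *s graph_vec (\<lambda>_. 0) v" for y a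
    unfolding scale_codeword codeword_eq_iff [OF assms]
    by (simp add: graph_vec_def vec_eq_iff split_option_all)
  ultimately show ?thesis
    by (simp add: minimal_codeword_def code covers_codeword_iff)
qed

text \<open>Passes between indexed families and sets. Independence of the image set alone would
  ignore repetitions, hence \<open>inj_on\<close>; the bound \<open>n \<le> card B\<close> suffices
  because subsets of independent sets are independent.\<close>

lemma independent_image_family_iff:
  "(\<exists>\<alpha> :: nat \<Rightarrow> 'b. (\<forall>i\<in>{1..n}. \<alpha> i \<in> A) \<and> inj_on (\<lambda>i. g (\<alpha> i)) {1..n} \<and>
      vec.independent ((\<lambda>i. g (\<alpha> i)) ` {1..n})) \<longleftrightarrow>
    (\<exists>B\<subseteq>g ` A. vec.independent B \<and> n \<le> card B)" (is "?L \<longleftrightarrow> ?R")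
  for g :: "'b \<Rightarrow> ('a :: field) ^ 'n"
proof
  assume ?L
  then obtain \<alpha> :: "nat \<Rightarrow> 'b" where \<alpha>: "\<forall>i\<in>{1..n}. \<alpha> i \<in> A" "inj_on (\<lambda>i. g (\<alpha> i)) {1..n}"
    "vec.independent ((\<lambda>i. g (\<alpha> i)) ` {1..n})" by blast
  show ?R
    by (rule exI [of _ "(\<lambda>i. g (\<alpha> i)) ` {1..n}"]) (use \<alpha> in \<open>auto simp: card_image\<close>)
next
  assume ?R
  then obtain B where B: "B \<subseteq> g ` A" "vec.independent B" "n \<le> card B" by blast
  obtain D where D: "D \<subseteq> B" "card D = n" "finite D"
    using B(3) obtain_subset_with_card_n by metis
  \<comment> \<open>\<open>A'\<close> holds one preimage for each element of \<open>D\<close>, so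
    enumerating it lists \<open>D\<close> without repetition.\<close>
  obtain A' where A': "A' \<subseteq> A" "inj_on g A'" "D = g ` A'"
    using D(1) B(1) by (meson subset_image_inj subset_trans)
  have "finite A'" "card A' = n"
    using A' D by (auto simp: finite_image_iff card_image)
  then obtain \<alpha> where \<alpha>: "bij_betw \<alpha> {1..n} A'"
    using ex_bij_betw_nat_finite_1 by blast
  then have "\<alpha> ` {1..n} = A'" "inj_on \<alpha> {1..n}"
    by (auto simp: bij_betw_def)
  then have "(\<lambda>i. g (\<alpha> i)) ` {1..n} = D" "inj_on (\<lambda>i. g (\<alpha> i)) {1..n}" "\<forall>i\<in>{1..n}. \<alpha> i \<in> A"
    using A' comp_inj_on [of \<alpha> "{1..n}" g] by (simp_all add: o_def flip: image_image, blast)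
  then show ?L
    using vec.independent_mono [OF B(2) D(1)] by metis
qed

theorem proposition3p5:
  fixes f :: "('a :: {field, finite}) ^ 'm \<Rightarrow> 'a" and v :: "'a ^ 'm"
  assumes "\<And>w :: 'a ^ 'm. \<exists>x. x \<noteq> 0 \<and> f x \<noteq> w \<odot> x"
    and "v \<noteq> 0"
  shows "minimal_codeword (code_of f) (codeword f 0 v) \<longleftrightarrow>
    (\<exists>\<alpha> :: nat \<Rightarrow> 'a ^ 'm.
      (\<forall>i\<in>{1..CARD('m)}. \<alpha> i \<in> hyperplane v - {0}) \<and>
      inj_on (\<lambda>i. graph_vec f (\<alpha> i)) {1..CARD('m)} \<and>
      vec.independent ((\<lambda>i. graph_vec f (\<alpha> i)) ` {1..CARD('m)}))"
proof -
  let ?S = "graph_vec f ` (hyperplane v - {0})" and ?z = "graph_vec (\<lambda>_. 0) v :: 'a ^ 'm option"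
  have z_ne: "?z \<noteq> 0"
    using assms(2) by (simp add: graph_vec_def vec_eq_iff split_option_all)
  have z_ann: "?S \<subseteq> hyperplane ?z"
  proof -
    \<comment> \<open>The coordinate \<open>None\<close> of \<open>?z\<close> is 0, which removes
      the term with \<open>f x\<close>.\<close>
    have "graph_vec f x \<odot> ?z = x \<odot> v" for x
      by (subst dot_commute, subst dot_graph_vec, subst dot_commute) (simp add: graph_vec_def)
    then show ?thesis by (auto simp: hyperplane_def)
  qed
  have "minimal_codeword (code_of f) (codeword f 0 v) \<longleftrightarrow>
      (\<forall>y. ?S \<subseteq> hyperplane y \<longrightarrow> (\<exists>a. y = a *s ?z))"
    by (rule minimal_codeword_iff_annihilator [OF assms(1)])
  also have "\<dots> \<longleftrightarrow> (\<exists>B\<subseteq>?S. vec.independent B \<and> CARD('m option) \<le> Suc (card B))" (is "?A \<longleftrightarrow> ?R")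
  proof
    assume ?A
    then show ?R by (intro annihilator_line_imp_rank [of ?S ?z]) blast
  next
    assume ?R
    then obtain B where B: "B \<subseteq> ?S" "vec.independent B" "CARD('m option) \<le> Suc (card B)" by blast
    then show ?A
      using annihilator_proportional [OF B(2,3)] z_ann z_ne by (meson subset_trans)
  qed
  \<comment> \<open>The ambient dimension is m + 1, so codimension at most one means rank at least
    m.\<close>
  also have "\<dots> \<longleftrightarrow> (\<exists>B\<subseteq>?S. vec.independent B \<and> CARD('m) \<le> card B)"
    by simp
  finally show ?thesis
    unfolding independent_image_family_iff .
qed

end
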